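(* Let $a,b,c,d\in\mathbb{C}$, $\delta\in(0,\pi)$, $c\notin\mathbb{Z}_{\leqslant 0}$ and $z\in\mathbb{C}$, $z\neq0$. Then for any positive integer $N$, $${}_2F_2\biggl[\begin{matrix}a,b+\lambda\\ c,d+\lambda\end{matrix};z\biggr]=\sum_{k=0}^{N-1}\frac{(a)_k(d-b)_k}{(c)_k(d+\lambda)_k}\frac{(-z)^k}{k!}\,{}_1F_1\biggl[\begin{matrix}a+k\\ c+k\end{matrix};z\biggr]+\mathcal{O}\bigl(\lambda^{-N}\bigr)$$ as $\lambda\to\infty$ in the sector $|\arg(\lambda+d)|\leqslant\pi-\delta$ (all of $a,b,c,d,z,N,\delta$ being fixed).
   Context: $(\cdot)_k$ is the Pochhammer symbol and ${}_pF_q\bigl[\begin{smallmatrix}a_1,\dots,a_p\\ b_1,\dots,b_q\end{smallmatrix};z\bigr]=\sum_{n=0}^{\infty}\frac{(a_1)_n\cdots(a_p)_n}{(b_1)_n\cdots(b_q)_n}\frac{z^n}{n!}$ is the generalized hypergeometric function, with $a_j\in\mathbb{C}$ and $b_j\in\mathbb{C}\setminus\mathbb{Z}_{\leqslant0}$. *)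

theory Defs
  imports "HOL-Analysis.Analysis" "HOL-Library.Landau_Symbols"
begin

(* The value at z of the generalized hypergeometric series pFq, with p = length as and
   q = length bs; hypergeo_pFq_series below gives its textbook form.
   Meaningful when no element of bs is a non-positive integer (otherwise x / 0 = 0 gives
   junk values) and the series converges (otherwise suminf gives a junk value); for p \<le> q
   it converges for every z. *)
definition hypergeo_pFq :: "complex list \<Rightarrow> complex list \<Rightarrow> complex \<Rightarrow> complex" where
  "hypergeo_pFq as bs z = eval_fps (fps_hypergeo as bs 1) z"

lemma hypergeo_pFq_series:
  "hypergeo_pFq as bs z =
     (\<Sum>n. (\<Prod>a\<leftarrow>as. pochhammer a n) / (\<Prod>b\<leftarrow>bs. pochhammer b n) * (z ^ n / fact n))"
proof -
  have foldl_eq: "foldl (\<lambda>r a. r * pochhammer a n) v xs = v * (\<Prod>a\<leftarrow>xs. pochhammer a n)"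
    for v :: complex and xs n
    by (induction xs arbitrary: v) (simp_all add: mult.assoc)
  show ?thesis
    by (simp add: hypergeo_pFq_def eval_fps_def foldl_eq)
qed

(* The filter "l tends to infinity with |arg (l + d)| \<le> \<theta>".  Arg is the principal argument
   with values in (-\<pi>, \<pi>]; the convention Arg 0 = 0 is irrelevant here since the filter
   only sees large l. *)
definition at_infinity_sector :: "complex \<Rightarrow> real \<Rightarrow> complex filter" where
  "at_infinity_sector d \<theta> = inf at_infinity (principal {l. \<bar>Arg (l + d)\<bar> \<le> \<theta>})"

end

theory Submission
  imports Defs
begin

text \<open>
  Write \<open>\<mu> = d + \<lambda>\<close> and \<open>e = d - b\<close>, so that the series on the left has the coefficients
  \<open>(a)\<^sub>n (\<mu> - e)\<^sub>n / ((c)\<^sub>n (\<mu>)\<^sub>n)\<close>. The Chu--Vandermonde identity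
  \<open>(\<mu> - e)\<^sub>n / (\<mu>)\<^sub>n = \<Sum>\<^sub>k\<^sub>\<le>\<^sub>n (n choose k) (-1)\<^sup>k (e)\<^sub>k / (\<mu>)\<^sub>k\<close>
  expands the quotient that depends on \<open>\<lambda>\<close> into inverse factorials of \<open>\<mu>\<close>
  (\<open>pochhammer_quotient_expansion\<close>). For a fixed \<open>k\<close>, summing its \<open>k\<close>-th term over \<open>n\<close> and
  shifting the index \<open>n\<close> by \<open>k\<close> gives exactly the \<open>k\<close>-th term of the claimed expansion
  (\<open>sums_binomial_kummer\<close>). Hence the error is the sum over \<open>n\<close> of the parts with
  \<open>N \<le> k \<le> n\<close>, and no interchange of two infinite summations is involved.

  In the sector, \<open>\<mu> + j\<close> stays away from the origin: \<open>\<bar>\<mu> + j\<bar> \<ge> sin \<delta> max(\<bar>\<mu>\<bar>, j)\<close>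
  (\<open>norm_add_nonneg_ge_sin\<close>). In \<open>(e)\<^sub>k / (\<mu>)\<^sub>k\<close> each of the first \<open>N\<close> factors is therefore
  \<open>O(1 / \<bar>\<mu>\<bar>)\<close>, and each later one is at most
  \<open>A = 2 / sin \<delta>\<close> as soon as \<open>\<bar>\<mu>\<bar> \<ge> \<bar>e\<bar>\<close> (\<open>norm_pochhammer_quotient_le\<close>). So the error is at most a constant times \<open>\<bar>\<mu>\<bar>\<^sup>-\<^sup>N\<close> times
  the sum over \<open>n\<close> of \<open>\<bar>(a)\<^sub>n / (c)\<^sub>n\<bar> (\<bar>z\<bar> (1 + A))\<^sup>n / n!\<close>, a convergent series that is
  independent of \<open>\<lambda>\<close>.
\<close>

section \<open>Kummer's series\<close>

text \<open>The ratio of consecutive terms is \<open>(a + n) x / ((c + n) (n + 1))\<close>, which tends to 0.\<close>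

lemma summable_norm_kummer:
  fixes a c x :: complex
  shows "summable (\<lambda>n. norm (pochhammer a n / pochhammer c n * (x ^ n / fact n)))"
proof -
  \<comment> \<open>From \<open>n0\<close> on, \<open>(a + n) / (c + n)\<close> is at most 4 and \<open>x / (n + 1)\<close> at most 1/8 in norm.\<close>
  obtain n0 :: nat where n0: "real n0 \<ge> 2 * norm a + 2 * norm c + 8 * norm x + 1"
    using real_arch_simple by blast
  show ?thesis
  proof (rule summable_ratio_test[where c = "1/2" and N = n0])
    fix n assume "n \<ge> n0"
    then have n: "real n \<ge> 2 * norm a + 2 * norm c + 8 * norm x + 1"
      using n0 by linarith
    have num: "norm (a + of_nat n) \<le> 2 * real n"
      using norm_triangle_ineq[of a "of_nat n"] n
        norm_ge_zero[of a] norm_ge_zero[of c] norm_ge_zero[of x]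
      unfolding norm_of_nat by linarith
    have den: "norm (c + of_nat n) \<ge> real n / 2"
      using norm_diff_ineq[of "of_nat n" c] n
        norm_ge_zero[of a] norm_ge_zero[of c] norm_ge_zero[of x]
      unfolding norm_of_nat add.commute[of c] by linarith
    have "real n > 0" using n norm_ge_zero[of a] norm_ge_zero[of c] norm_ge_zero[of x] by linarith
    have "norm ((a + of_nat n) / (c + of_nat n)) \<le> (2 * real n) / (real n / 2)"
      unfolding norm_divide using num den \<open>real n > 0\<close> by (intro frac_le) auto
    also have "\<dots> = 4" using \<open>real n > 0\<close> by simp
    finally have 1: "norm ((a + of_nat n) / (c + of_nat n)) \<le> 4" .
    have 2: "norm (x / of_nat (Suc n)) \<le> 1 / 8"
    proof -
      have "8 * norm x \<le> real (Suc n)"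
        using n norm_ge_zero[of a] norm_ge_zero[of c] by linarith
      then show ?thesis by (simp add: norm_divide divide_simps del: of_nat_Suc)
    qed
    have 3: "norm ((a + of_nat n) / (c + of_nat n)) * norm (x / of_nat (Suc n)) \<le> 1 / 2"
      using mult_mono[OF 1 2] by simp
    have "pochhammer a (Suc n) / pochhammer c (Suc n) * (x ^ Suc n / fact (Suc n)) =
        ((a + of_nat n) / (c + of_nat n) * (x / of_nat (Suc n)))
          * (pochhammer a n / pochhammer c n * (x ^ n / fact n))"
      by (simp add: pochhammer_rec' mult_ac del: of_nat_Suc)
    then show "norm (norm (pochhammer a (Suc n) / pochhammer c (Suc n) * (x ^ Suc n / fact (Suc n))))
        \<le> 1 / 2 * norm (norm (pochhammer a n / pochhammer c n * (x ^ n / fact n)))"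
      using mult_right_mono[OF 3 norm_ge_zero[of "pochhammer a n / pochhammer c n * (x ^ n / fact n)"]]
      by (simp only: norm_mult real_norm_def abs_mult abs_norm_cancel mult.assoc)
  qed simp
qed

lemma sums_kummer:
  "(\<lambda>n. pochhammer a n / pochhammer c n * (z ^ n / fact n)) sums hypergeo_pFq [a] [c] z"
  using summable_sums[OF summable_norm_cancel[OF summable_norm_kummer]]
  by (simp add: hypergeo_pFq_series)

text \<open>The factor \<open>n choose k\<close> removes the terms with \<open>n < k\<close> and turns \<open>n!\<close> into \<open>k! (n - k)!\<close>;
  splitting off the first \<open>k\<close> factors of each Pochhammer symbol leaves Kummer's series with
  both parameters raised by \<open>k\<close>.\<close>

lemma sums_binomial_kummer:
  fixes a c z :: complex
  shows "(\<lambda>n. pochhammer a n / pochhammer c n * (z ^ n / fact n) * of_nat (n choose k)) sums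
    (pochhammer a k / pochhammer c k * (z ^ k / fact k)
      * hypergeo_pFq [a + of_nat k] [c + of_nat k] z)"
    (is "?f sums ?s")
proof -
  have "?f (n + k) = pochhammer a k / pochhammer c k * (z ^ k / fact k) *
     (pochhammer (a + of_nat k) n / pochhammer (c + of_nat k) n * (z ^ n / fact n))" for n
  proof -
    have "of_nat ((n + k) choose k) = (fact (n + k) / (fact k * fact n) :: complex)"
      by (simp add: binomial_fact)
    moreover have "pochhammer y (n + k) = pochhammer y k * pochhammer (y + of_nat k) n"
      for y :: complex
      using pochhammer_product'[of y k n] by (simp add: add.commute)
    ultimately show ?thesis by (simp add: power_add mult_ac)
  qed
  then have "(\<lambda>n. ?f (n + k)) sums ?s"
    by (simp only: sums_mult[OF sums_kummer])
  then show ?thesis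
    by (subst (asm) sums_zero_iff_shift) (auto simp: binomial_eq_0)
qed

section \<open>Expansion in inverse factorials\<close>

text \<open>This is the Chu--Vandermonde sum for \<open>\<^sub>2F\<^sub>1(-n, e; \<mu>; 1)\<close>.\<close>

lemma pochhammer_quotient_expansion:
  fixes e \<mu> :: "'a :: field_char_0"
  assumes "\<And>j. \<mu> + of_nat j \<noteq> 0"
  shows "pochhammer (\<mu> - e) n / pochhammer \<mu> n =
    (\<Sum>k\<le>n. of_nat (n choose k) * ((- 1) ^ k * (pochhammer e k / pochhammer \<mu> k)))"
proof -
  have "\<forall>i\<in>{0..<n}. \<mu> \<noteq> - of_nat i"
    using assms by (auto simp: eq_neg_iff_add_eq_0)
  note Vandermonde_pochhammer[OF this, of e, symmetric]
  also have "(\<Sum>k = 0..n. pochhammer e k * pochhammer (- of_nat n) k / (of_nat (fact k) * pochhammer \<mu> k))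
    = (\<Sum>k\<le>n. of_nat (n choose k) * ((- 1) ^ k * (pochhammer e k / pochhammer \<mu> k)))"
  proof (rule sum.cong)
    fix k
    have "pochhammer (- of_nat n) k = (- 1) ^ k * of_nat (n choose k) * (fact k :: 'a)"
      by (simp add: binomial_gbinomial gbinomial_pochhammer flip: power_mult_distrib)
    then show "pochhammer e k * pochhammer (- of_nat n) k / (of_nat (fact k) * pochhammer \<mu> k)
      = of_nat (n choose k) * ((- 1) ^ k * (pochhammer e k / pochhammer \<mu> k))"
      by simp
  qed auto
  finally show ?thesis .
qed

section \<open>Bounds in the sector\<close>

text \<open>With \<open>r = \<bar>w\<bar>\<close>, the hypothesis gives \<open>Re w \<ge> - r cos \<delta>\<close>, so \<open>\<bar>w + t\<bar>\<^sup>2\<close> is at least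
  \<open>r\<^sup>2 - 2 r t cos \<delta> + t\<^sup>2\<close>, the squared side opposite \<open>\<delta>\<close> in a triangle with sides \<open>r\<close> and
  \<open>t\<close>. That side is at least as long as each of the two altitudes \<open>r sin \<delta>\<close> and \<open>t sin \<delta>\<close>.\<close>

lemma norm_add_nonneg_ge_sin:
  fixes w :: complex and \<delta> t :: real
  assumes "0 < \<delta>" "\<delta> < pi" "\<bar>Arg w\<bar> \<le> pi - \<delta>" "t \<ge> 0"
  shows "norm (w + of_real t) \<ge> sin \<delta> * max (norm w) t"
proof -
  have Re_w: "Re w = norm w * cos (Arg w)"
    using arg_cong[OF rcis_cmod_Arg[of w], of Re] by simp
  have "cos (pi - \<delta>) \<le> cos \<bar>Arg w\<bar>"
    using assms by (intro cos_monotone_0_pi_le) auto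
  then have "- cos \<delta> \<le> cos (Arg w)" by (simp add: cos_abs_real)
  then have "norm w * - cos \<delta> \<le> Re w"
    unfolding Re_w by (intro mult_left_mono) auto
  then have "t * (norm w * - cos \<delta>) \<le> t * Re w"
    using assms by (intro mult_left_mono) auto
  moreover have "(norm (w + of_real t))\<^sup>2 = (norm w)\<^sup>2 + 2 * (t * Re w) + t\<^sup>2"
    by (simp add: cmod_power2 power2_sum algebra_simps)
  ultimately have le: "(norm w)\<^sup>2 - 2 * t * norm w * cos \<delta> + t\<^sup>2 \<le> (norm (w + of_real t))\<^sup>2"
    by (simp add: mult_ac)
  have sc: "(sin \<delta>)\<^sup>2 = 1 - (cos \<delta>)\<^sup>2"
    by (rule sin_squared_eq)
  have "(sin \<delta> * norm w)\<^sup>2 = (norm w)\<^sup>2 - 2 * t * norm w * cos \<delta> + t\<^sup>2 - (t - norm w * cos \<delta>)\<^sup>2"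
    unfolding power_mult_distrib sc by (simp add: power2_eq_square algebra_simps)
  then have 1: "(sin \<delta> * norm w)\<^sup>2 \<le> (norm (w + of_real t))\<^sup>2"
    using le zero_le_power2[of "t - norm w * cos \<delta>"] by linarith
  have "(sin \<delta> * t)\<^sup>2 = (norm w)\<^sup>2 - 2 * t * norm w * cos \<delta> + t\<^sup>2 - (norm w - t * cos \<delta>)\<^sup>2"
    unfolding power_mult_distrib sc by (simp add: power2_eq_square algebra_simps)
  then have 2: "(sin \<delta> * t)\<^sup>2 \<le> (norm (w + of_real t))\<^sup>2"
    using le zero_le_power2[of "norm w - t * cos \<delta>"] by linarith
  show ?thesis
    using power2_le_imp_le[OF 1] power2_le_imp_le[OF 2] by (auto simp: max_def)
qed

text \<open>Each of the first \<open>N\<close> factors \<open>(e + j) / (\<mu> + j)\<close> is at most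
  \<open>(\<bar>e\<bar> + N) / (s \<bar>\<mu>\<bar>)\<close>; this is where the decay in \<open>\<mu>\<close> comes from. For the others,
  \<open>\<bar>e + j\<bar> \<le> \<bar>\<mu>\<bar> + j \<le> 2 max(\<bar>\<mu>\<bar>, j)\<close>.\<close>

lemma norm_pochhammer_quotient_le:
  fixes e \<mu> :: complex and s :: real
  assumes s: "0 < s" "s \<le> 1"
    and away: "\<And>j. s * max (norm \<mu>) (real j) \<le> norm (\<mu> + of_nat j)"
    and \<mu>: "\<mu> \<noteq> 0" "norm e \<le> norm \<mu>"
    and "N \<le> k"
  shows "norm (pochhammer e k / pochhammer \<mu> k) \<le> ((norm e + N) / s) ^ N / norm \<mu> ^ N * (2 / s) ^ k"
proof -
  define B where "B = (norm e + N) / (s * norm \<mu>)"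
  have B0: "B \<ge> 0" using s by (simp add: B_def)
  have ratio: "norm (pochhammer e (Suc j) / pochhammer \<mu> (Suc j)) =
      norm (pochhammer e j / pochhammer \<mu> j) * norm ((e + of_nat j) / (\<mu> + of_nat j))" for j
    by (simp add: pochhammer_rec' norm_mult norm_divide mult_ac)
  have num: "norm (e + of_nat j) \<le> norm e + real j" for j
    using norm_triangle_ineq[of e "of_nat j"] by simp
  have early: "norm ((e + of_nat j) / (\<mu> + of_nat j)) \<le> B" if "j \<le> N" for j
  proof -
    have "s * norm \<mu> \<le> norm (\<mu> + of_nat j)"
      by (rule order_trans[OF mult_left_mono away]) (use s in auto)
    then show ?thesis
      unfolding B_def norm_divide using num[of j] that s \<mu> by (intro frac_le) auto
  qed
  have late: "norm ((e + of_nat j) / (\<mu> + of_nat j)) \<le> 2 / s" for j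
  proof -
    have pos: "0 < s * max (norm \<mu>) (real j)" using s \<mu> by (simp add: less_max_iff_disj)
    have "norm ((e + of_nat j) / (\<mu> + of_nat j)) \<le> (2 * max (norm \<mu>) j) / (s * max (norm \<mu>) j)"
      unfolding norm_divide using num[of j] \<mu> pos away[of j] by (intro frac_le) auto
    also have "\<dots> = 2 / s" using pos by auto
    finally show ?thesis .
  qed
  have *: "norm (pochhammer e j / pochhammer \<mu> j) \<le> B ^ j" if "j \<le> N" for j
    using that
  proof (induction j)
    case (Suc j)
    have "norm (pochhammer e j / pochhammer \<mu> j) * norm ((e + of_nat j) / (\<mu> + of_nat j)) \<le> B ^ j * B"
      by (rule mult_mono) (use Suc early[of j] B0 in auto)
    then show ?case unfolding ratio by (simp add: mult.commute)
  qed simp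
  have "norm (pochhammer e k / pochhammer \<mu> k) \<le> B ^ N * (2 / s) ^ (k - N)"
    using \<open>N \<le> k\<close>
  proof (induction k rule: dec_induct)
    case base
    show ?case using *[of N] by simp
  next
    case (step j)
    have "norm (pochhammer e (Suc j) / pochhammer \<mu> (Suc j)) \<le> B ^ N * (2 / s) ^ (j - N) * (2 / s)"
      unfolding ratio
      by (rule mult_mono) (use step late[of j] B0 s in auto)
    then show ?case using step by (simp add: Suc_diff_le mult_ac)
  qed
  also have "\<dots> \<le> B ^ N * (2 / s) ^ k"
    using s B0 by (intro mult_left_mono power_increasing) auto
  also have "B ^ N = ((norm e + N) / s) ^ N / norm \<mu> ^ N"
    by (simp add: B_def power_divide power_mult_distrib)
  finally show ?thesis .
qed

text \<open>In the remainder of order \<open>N\<close>, the bound above meets the binomial theorem, which turns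
  \<open>(2 / s)\<^sup>k\<close> into \<open>(1 + 2 / s)\<^sup>n\<close>.\<close>

lemma norm_expansion_remainder_le:
  fixes e \<mu> :: complex and s :: real
  assumes s: "0 < s" "s \<le> 1"
    and away: "\<And>j. s * max (norm \<mu>) (real j) \<le> norm (\<mu> + of_nat j)"
    and \<mu>: "\<mu> \<noteq> 0" "norm e \<le> norm \<mu>"
  shows "norm (pochhammer (\<mu> - e) n / pochhammer \<mu> n
            - (\<Sum>k<N. of_nat (n choose k) * ((- 1) ^ k * (pochhammer e k / pochhammer \<mu> k))))
       \<le> ((norm e + N) / s) ^ N / norm \<mu> ^ N * (1 + 2 / s) ^ n"
proof -
  define v where "v k = of_nat (n choose k) * ((- 1) ^ k * (pochhammer e k / pochhammer \<mu> k))" for k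
  define C where "C = ((norm e + N) / s) ^ N / norm \<mu> ^ N"
  have C0: "C \<ge> 0" using s by (simp add: C_def)
  have nz: "\<mu> + of_nat j \<noteq> 0" for j
  proof -
    have "0 < s * max (norm \<mu>) (real j)" using s \<mu> by (simp add: less_max_iff_disj)
    then show ?thesis using away[of j] by auto
  qed
  have "pochhammer (\<mu> - e) n / pochhammer \<mu> n = sum v {..n}"
    unfolding v_def by (rule pochhammer_quotient_expansion[OF nz])
  also have "\<dots> = sum v {..<N} + sum v {N..n}"
  proof -
    \<comment> \<open>If \<open>n < N\<close>, the additional indices \<open>n < k < N\<close> contribute nothing, as \<open>n choose k = 0\<close>.\<close>
    have "sum v {..n} = sum v ({..<N} \<union> {N..n})"
      by (rule sum.mono_neutral_left) (auto simp: v_def binomial_eq_0)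
    also have "\<dots> = sum v {..<N} + sum v {N..n}"
      by (rule sum.union_disjoint) auto
    finally show ?thesis .
  qed
  finally have "pochhammer (\<mu> - e) n / pochhammer \<mu> n - sum v {..<N} = sum v {N..n}" by simp
  moreover have "norm (sum v {N..n}) \<le> (\<Sum>k\<in>{N..n}. C * (real (n choose k) * (2 / s) ^ k))"
  proof (rule sum_norm_le)
    fix k assume "k \<in> {N..n}"
    then have "norm (pochhammer e k / pochhammer \<mu> k) \<le> C * (2 / s) ^ k"
      unfolding C_def using norm_pochhammer_quotient_le[OF s away \<mu>] by auto
    then have "real (n choose k) * norm (pochhammer e k / pochhammer \<mu> k)
        \<le> real (n choose k) * (C * (2 / s) ^ k)"
      by (intro mult_left_mono) auto
    moreover have "norm (v k) = real (n choose k) * norm (pochhammer e k / pochhammer \<mu> k)"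
      unfolding v_def by (simp only: norm_mult norm_power norm_of_nat) simp
    ultimately show "norm (v k) \<le> C * (real (n choose k) * (2 / s) ^ k)"
      by (simp only: mult.left_commute)
  qed
  moreover have "\<dots> \<le> (\<Sum>k\<le>n. C * (real (n choose k) * (2 / s) ^ k))"
    by (rule sum_mono2) (use s C0 in auto)
  moreover have "\<dots> = C * (1 + 2 / s) ^ n"
    using binomial_ring[of "2 / s" "1 :: real" n] by (simp add: sum_distrib_left add.commute)
  ultimately show ?thesis unfolding v_def C_def by simp
qed

section \<open>The asymptotic expansion\<close>

text \<open>The remainder is the series whose \<open>n\<close>-th term is the \<open>n\<close>-th term of Kummer's series times
  the remainder of \<open>(\<mu> - e)\<^sub>n / (\<mu>)\<^sub>n\<close>; it is dominated by Kummer's series at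
  \<open>(1 + 2 / s) z\<close>.\<close>

lemma norm_hypergeo_remainder_le:
  fixes a c e \<mu> z :: complex and s :: real
  assumes s: "0 < s" "s \<le> 1"
    and away: "\<And>j. s * max (norm \<mu>) (real j) \<le> norm (\<mu> + of_nat j)"
    and \<mu>: "\<mu> \<noteq> 0" "norm e \<le> norm \<mu>"
  shows "norm (hypergeo_pFq [a, \<mu> - e] [c, \<mu>] z
            - (\<Sum>k<N. pochhammer a k * pochhammer e k / (pochhammer c k * pochhammer \<mu> k)
                 * ((- z) ^ k / fact k) * hypergeo_pFq [a + of_nat k] [c + of_nat k] z))
     \<le> ((norm e + N) / s) ^ N / norm \<mu> ^ N *
        (\<Sum>n. norm (pochhammer a n / pochhammer c n * ((of_real (1 + 2 / s) * z) ^ n / fact n)))"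
proof -
  define t where "t n = pochhammer a n / pochhammer c n * (z ^ n / fact n)" for n
  define q where "q k = (- 1) ^ k * (pochhammer e k / pochhammer \<mu> k)" for k
  define R where "R n = pochhammer (\<mu> - e) n / pochhammer \<mu> n - (\<Sum>k<N. of_nat (n choose k) * q k)" for n
  define C where "C = ((norm e + N) / s) ^ N / norm \<mu> ^ N"
  define g where "g n = norm (pochhammer a n / pochhammer c n * ((of_real (1 + 2 / s) * z) ^ n / fact n))" for n
  define T where "T k = pochhammer a k * pochhammer e k / (pochhammer c k * pochhammer \<mu> k)
                 * ((- z) ^ k / fact k) * hypergeo_pFq [a + of_nat k] [c + of_nat k] z" for k
  have g: "summable g" unfolding g_def by (rule summable_norm_kummer)
  have dom: "norm (t n * R n) \<le> C * g n" for n
  proof -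
    have "norm (R n) \<le> C * (1 + 2 / s) ^ n"
      unfolding R_def q_def C_def by (rule norm_expansion_remainder_le[OF s away \<mu>])
    from mult_left_mono[OF this, of "norm (t n)"]
    have "norm (t n * R n) \<le> norm (t n) * (C * (1 + 2 / s) ^ n)" by (simp add: norm_mult)
    also have "norm (t n) * (1 + 2 / s) ^ n = g n"
    proof -
      have "norm (of_real (1 + 2 / s) :: complex) = 1 + 2 / s"
        unfolding norm_of_real using s by simp
      then show ?thesis
        unfolding g_def t_def
        by (simp only: norm_mult norm_divide norm_power power_mult_distrib) simp
    qed
    then have "norm (t n) * (C * (1 + 2 / s) ^ n) = C * g n" by (simp add: mult_ac)
    finally show ?thesis .
  qed
  have summ: "summable (\<lambda>n. t n * R n)"
    by (rule summable_comparison_test'[OF summable_mult[OF g, of C], of 0]) (use dom in auto)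
  have term_k: "(\<lambda>n. t n * (of_nat (n choose k) * q k)) sums T k" for k
  proof -
    have "(\<lambda>n. t n * of_nat (n choose k) * q k) sums
       (pochhammer a k / pochhammer c k * (z ^ k / fact k)
        * hypergeo_pFq [a + of_nat k] [c + of_nat k] z * q k)"
      unfolding t_def by (rule sums_mult2[OF sums_binomial_kummer])
    moreover have "pochhammer a k / pochhammer c k * (z ^ k / fact k)
        * hypergeo_pFq [a + of_nat k] [c + of_nat k] z * q k = T k"
      unfolding T_def q_def power_minus[of z] by (simp add: mult_ac)
    ultimately show ?thesis by (simp add: mult.assoc)
  qed
  have "(\<lambda>n. (\<Sum>k<N. t n * (of_nat (n choose k) * q k)) + t n * R n) sums
      ((\<Sum>k<N. T k) + (\<Sum>n. t n * R n))"
    by (intro sums_add sums_sum summable_sums summ term_k)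
  moreover have "(\<Sum>k<N. t n * (of_nat (n choose k) * q k)) + t n * R n
      = t n * (pochhammer (\<mu> - e) n / pochhammer \<mu> n)" for n
    unfolding R_def sum_distrib_left[symmetric] by (simp add: right_diff_distrib)
  ultimately have "(\<lambda>n. t n * (pochhammer (\<mu> - e) n / pochhammer \<mu> n)) sums
      ((\<Sum>k<N. T k) + (\<Sum>n. t n * R n))"
    by simp
  moreover have "hypergeo_pFq [a, \<mu> - e] [c, \<mu>] z = (\<Sum>n. t n * (pochhammer (\<mu> - e) n / pochhammer \<mu> n))"
    unfolding hypergeo_pFq_series t_def by (simp add: mult_ac)
  ultimately have "hypergeo_pFq [a, \<mu> - e] [c, \<mu>] z - (\<Sum>k<N. T k) = (\<Sum>n. t n * R n)"
    by (simp add: sums_iff)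
  moreover have "norm (\<Sum>n. t n * R n) \<le> (\<Sum>n. C * g n)"
    by (rule norm_suminf_le[OF dom summable_mult[OF g]])
  moreover have "(\<Sum>n. C * g n) = C * (\<Sum>n. g n)"
    by (rule suminf_mult[OF g])
  ultimately show ?thesis
    by (simp add: T_def C_def g_def)
qed

theorem theorem4p1:
  fixes a b c d z :: complex and \<delta> :: real and N :: nat
  assumes "0 < \<delta>" "\<delta> < pi"
    and "c \<notin> \<int>\<^sub>\<le>\<^sub>0"
    and "z \<noteq> 0"
    and "N > 0"
  shows "(\<lambda>l. hypergeo_pFq [a, b + l] [c, d + l] z
            - (\<Sum>k<N. pochhammer a k * pochhammer (d - b) k / (pochhammer c k * pochhammer (d + l) k)
                 * ((- z) ^ k / fact k)
                 * hypergeo_pFq [a + of_nat k] [c + of_nat k] z))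
         \<in> O[at_infinity_sector d (pi - \<delta>)](\<lambda>l. 1 / l ^ N)"
    (is "?err \<in> _")
proof -
  define s where "s = sin \<delta>"
  define C where "C = ((norm (d - b) + N) / s) ^ N"
  define K where "K = (\<Sum>n. norm (pochhammer a n / pochhammer c n * ((of_real (1 + 2 / s) * z) ^ n / fact n)))"
  have s: "0 < s" "s \<le> 1"
    using sin_gt_zero[of \<delta>] assms by (auto simp: s_def)
  have "K \<ge> 0"
    unfolding K_def by (rule suminf_nonneg[OF summable_norm_kummer]) simp
  have "C \<ge> 0" using s by (simp add: C_def)
  have bound: "norm (?err l) \<le> (C * K * 2 ^ N) * norm (1 / l ^ N)"
    if l: "norm l \<ge> 2 * norm d + 2 * norm (d - b) + 1" and sector: "\<bar>Arg (l + d)\<bar> \<le> pi - \<delta>" for l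
  proof -
    have "norm (d + l) \<ge> norm l - norm d"
      using norm_diff_ineq[of l d] by (simp add: add.commute)
    then have half: "norm l / 2 \<le> norm (d + l)" and large: "norm (d - b) \<le> norm (d + l)"
      using l norm_ge_zero[of d] norm_ge_zero[of "d - b"] norm_ge_zero[of l] by linarith+
    have lpos: "norm l > 0" using l norm_ge_zero[of d] norm_ge_zero[of "d - b"] by linarith
    have nz: "d + l \<noteq> 0" using half lpos by auto
    have away: "s * max (norm (d + l)) (real j) \<le> norm (d + l + of_nat j)" for j
      using norm_add_nonneg_ge_sin[OF assms(1,2) sector, of "real j"]
      by (simp add: s_def add.commute)
    have "norm (?err l) \<le> C / norm (d + l) ^ N * K"
      using norm_hypergeo_remainder_le[OF s away nz large, of a c z N]
      by (simp add: C_def K_def add.commute[of b])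
    also have "\<dots> \<le> C / (norm l / 2) ^ N * K"
      using half lpos \<open>C \<ge> 0\<close> \<open>K \<ge> 0\<close>
      by (intro mult_right_mono divide_left_mono power_mono) (auto intro!: mult_pos_pos simp: nz)
    also have "\<dots> = (C * K * 2 ^ N) * norm (1 / l ^ N)"
      by (simp add: norm_divide norm_power power_divide)
    finally show ?thesis .
  qed
  have "eventually (\<lambda>l. norm (?err l) \<le> (C * K * 2 ^ N) * norm (1 / l ^ N))
      (at_infinity_sector d (pi - \<delta>))"
    unfolding at_infinity_sector_def eventually_inf_principal eventually_at_infinity
    using bound by (intro exI[of _ "2 * norm d + 2 * norm (d - b) + 1"]) auto
  then show ?thesis by (rule bigoI)
qed

end
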